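(* Let $p_1\ge p_2\ge\cdots>0$ be a non-increasing sequence of strictly positive reals with $\sum_{j=1}^\infty p_j=1$, let $\rho_j:=\frac1{p_j}\sum_{i>j}p_i$, and let $V_n=\operatorname{Var}(K_n)$, where $K_n$ is the number of boxes occupied by at least one of the first $n$ balls. Consider the conditions: (a) for each integer $k\ge1$, $\ \liminf_{j\to\infty}\dfrac{p_{j+k}}{p_j}\ge\dfrac12$; (b) $\lim_{j\to\infty}\rho_j=\infty$; (c) $V_n\to\infty$ as $n\to\infty$. Then (a) implies (b), and (b) implies (c).
   Context: Infinite occupancy scheme: balls $1,2,\dots$ are thrown independently at boxes $j=1,2,\dots$, each ball landing in box $j$ with probability $p_j$. $K_n$ is the number of boxes containing at least one of the first $n$ balls; equivalently, the number of distinct values among $n$ i.i.d. positive-integer-valued random variables with distribution $(p_j)$. *)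

theory Defs
  imports "HOL-Probability.Probability"
begin

text \<open>Boxes and balls are numbered from 1: a probability sequence \<open>p\<close> is used only at
  indices \<open>j \<ge> 1\<close> (the value \<open>p 0\<close> is unconstrained and irrelevant), and
  \<open>X i \<omega>\<close>, for \<open>i \<ge> 1\<close>, is the box that receives ball \<open>i\<close>.\<close>

definition tail_ratio :: "(nat \<Rightarrow> real) \<Rightarrow> nat \<Rightarrow> real" where
  "tail_ratio p j = (\<Sum>m. p (j + 1 + m)) / p j"

definition num_occupied :: "(nat \<Rightarrow> 'w \<Rightarrow> nat) \<Rightarrow> nat \<Rightarrow> 'w \<Rightarrow> nat" where
  "num_occupied X n \<omega> = card {j. \<exists>i\<in>{1..n}. X i \<omega> = j}"

definition occupancy_variance :: "'w measure \<Rightarrow> (nat \<Rightarrow> 'w \<Rightarrow> nat) \<Rightarrow> nat \<Rightarrow> real" where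
  "occupancy_variance M X n = prob_space.variance M (\<lambda>\<omega>. real (num_occupied X n \<omega>))"

text \<open>Independent throws with distribution \<open>p\<close>. Measurability of each throw as a map into
  the discrete space of positive integers is part of \<open>indep_vars\<close>.\<close>

definition occupancy_scheme ::
    "'w measure \<Rightarrow> (nat \<Rightarrow> real) \<Rightarrow> (nat \<Rightarrow> 'w \<Rightarrow> nat) \<Rightarrow> bool" where
  "occupancy_scheme M p X \<longleftrightarrow>
     prob_space M \<and>
     prob_space.indep_vars M (\<lambda>_. count_space {1..}) X {1..} \<and>
     (\<forall>i\<ge>1. \<forall>j\<ge>1. measure M {\<omega> \<in> space M. X i \<omega> = j} = p j)"

end

theory Submission
  imports Defs
begin

text \<open>(a) implies (b) because \<open>\<rho>\<^sub>j\<close> dominates the sum of any \<open>k\<close> of the ratios \<open>p\<^sub>j\<^sub>+\<^sub>i / p\<^sub>j\<close>.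

  For (b) implies (c), project \<open>K\<^sub>n\<close> onto the centred number \<open>S\<close> of balls that land in a set \<open>B\<close> of
  boxes, of total probability \<open>q\<close>. Without ball \<open>i\<close>, the number of occupied boxes drops by the
  indicator that ball \<open>i\<close> is alone in its box, and what remains is independent of ball \<open>i\<close>; so only
  this indicator contributes to the covariance of \<open>K\<^sub>n\<close> and \<open>S\<close>. If a ball landing in a box of \<open>B\<close> is
  alone with probability at least \<open>d\<close>, while a ball is alone with probability \<open>c\<close> on average, the
  covariance is at least \<open>n q (d - c)\<close>, and since \<open>S\<close> has variance at most \<open>n q\<close>, Cauchy--Schwarz gives
  \<open>V\<^sub>n \<ge> n q (d - c)\<^sup>2\<close>. Now let \<open>j\<close> be the last box with \<open>2 n p\<^sub>j > 1\<close> and \<open>B\<close> the boxes after \<open>j\<close>: then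
  \<open>d = 1/2\<close> is admissible, \<open>c \<rightarrow> 0\<close>, and \<open>n q = n p\<^sub>j \<rho>\<^sub>j > \<rho>\<^sub>j / 2 \<rightarrow> \<infinity>\<close>.\<close>

section \<open>Variance bound from a centred test variable\<close>

text \<open>Expand the nonnegative mean of \<open>(K - m - t * S)\<^sup>2\<close> with
  \<open>m\<close> the mean of \<open>K\<close>; the term in \<open>m * S\<close> vanishes because
  \<open>S\<close> is centred. Leaving \<open>t\<close> free avoids dividing by the second moment of
  \<open>S\<close>, so that for \<open>t \<ge> 0\<close> one-sided estimates of both moments can be
  inserted.\<close>

lemma (in prob_space) variance_ge_projection:
  fixes K S :: "'a \<Rightarrow> real"
  assumes [measurable]: "K \<in> borel_measurable M" "S \<in> borel_measurable M"
    and K: "\<And>\<omega>. \<bar>K \<omega>\<bar> \<le> a" and S: "\<And>\<omega>. \<bar>S \<omega>\<bar> \<le> b" and mean: "expectation S = 0"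
  shows "2 * t * expectation (\<lambda>\<omega>. S \<omega> * K \<omega>) - t\<^sup>2 * expectation (\<lambda>\<omega>. S \<omega> * S \<omega>) \<le> variance K"
proof -
  define m where "m = expectation K"
  have mult: "integrable M (\<lambda>\<omega>. f \<omega> * g \<omega>)"
    if [measurable]: "f \<in> borel_measurable M" "g \<in> borel_measurable M"
      and f: "\<And>\<omega>. \<bar>f \<omega>\<bar> \<le> u" and g: "\<And>\<omega>. \<bar>g \<omega>\<bar> \<le> v" for f g :: "'a \<Rightarrow> real" and u v
  proof (rule integrable_const_bound[where B = "u * v"])
    have "0 \<le> u" using f[of undefined] by linarith
    then show "AE \<omega> in M. norm (f \<omega> * g \<omega>) \<le> u * v"
      using f g by (auto simp: abs_mult intro!: mult_mono)
  qed measurable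
  have [simp]: "integrable M K" "integrable M S" "integrable M (\<lambda>\<omega>. K \<omega> * K \<omega>)"
    "integrable M (\<lambda>\<omega>. S \<omega> * K \<omega>)" "integrable M (\<lambda>\<omega>. S \<omega> * S \<omega>)"
    using mult[of K "\<lambda>_. 1" a 1] mult[of S "\<lambda>_. 1" b 1] mult[of K K a a] mult[of S K b a]
      mult[of S S b b] K S by simp_all
  have [simp]: "integrable M (\<lambda>\<omega>. (K \<omega> - m)\<^sup>2)"
    by (simp add: power2_eq_square algebra_simps)
  have "0 \<le> expectation (\<lambda>\<omega>. (K \<omega> - m - t * S \<omega>)\<^sup>2)"
    by simp
  also have "(\<lambda>\<omega>. (K \<omega> - m - t * S \<omega>)\<^sup>2) =
      (\<lambda>\<omega>. (K \<omega> - m)\<^sup>2 - 2 * t * (S \<omega> * K \<omega>) + 2 * t * m * S \<omega> + t\<^sup>2 * (S \<omega> * S \<omega>))"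
    by (simp add: fun_eq_iff power2_eq_square algebra_simps)
  also have "expectation \<dots> = expectation (\<lambda>\<omega>. (K \<omega> - m)\<^sup>2) - 2 * t * expectation (\<lambda>\<omega>. S \<omega> * K \<omega>)
      + t\<^sup>2 * expectation (\<lambda>\<omega>. S \<omega> * S \<omega>)"
    by (simp add: mean)
  finally show ?thesis
    by (simp add: m_def)
qed

section \<open>Independent throws and the covariance estimate\<close>

locale occupancy = prob_space M
  for M :: "'w measure" +
  fixes p :: "nat \<Rightarrow> real" and X :: "nat \<Rightarrow> 'w \<Rightarrow> nat"
  assumes indep: "indep_vars (\<lambda>_. count_space {1..}) X {1..}"
    and prob_eq: "\<And>i j. i \<ge> 1 \<Longrightarrow> j \<ge> 1 \<Longrightarrow> prob {\<omega> \<in> space M. X i \<omega> = j} = p j"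
begin

lemma X_measurable: "i \<ge> 1 \<Longrightarrow> X i \<in> measurable M (count_space {1..})"
  using indep by (auto simp: indep_vars_def)

lemma X_pos: "i \<ge> 1 \<Longrightarrow> \<omega> \<in> space M \<Longrightarrow> X i \<omega> \<ge> 1"
  using measurable_space[OF X_measurable] by auto

lemma p_nonneg: "j \<ge> 1 \<Longrightarrow> 0 \<le> p j"
  using prob_eq[of 1 j, symmetric] by simp

lemma p_le_1: "j \<ge> 1 \<Longrightarrow> p j \<le> 1"
  using prob_eq[of 1 j, symmetric] by simp

text \<open>The tuple of finitely many throws lives in a countable space whose product sigma-algebra
  is discrete, so \<open>f\<close> may be arbitrary.\<close>

lemma tuple_measurable:
  assumes "finite J" "J \<subseteq> {1..}"
  shows "(\<lambda>\<omega>. f (restrict (\<lambda>l. X l \<omega>) J)) \<in> measurable M (count_space UNIV)"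
proof -
  have "(\<lambda>\<omega>. restrict (\<lambda>l. X l \<omega>) J) \<in> measurable M (PiM J (\<lambda>_. count_space {1..}))"
    using assms by (intro measurable_restrict X_measurable) auto
  then have "(\<lambda>\<omega>. restrict (\<lambda>l. X l \<omega>) J) \<in> measurable M (count_space (PiE J (\<lambda>_. {1..})))"
    using assms by (subst (asm) count_space_PiM_finite) auto
  then show ?thesis
    by (rule measurable_compose) simp
qed

lemma tuple_borel_measurable:
  assumes "finite J" "J \<subseteq> {1..}"
  shows "(\<lambda>\<omega>. f (restrict (\<lambda>l. X l \<omega>) J) :: real) \<in> borel_measurable M"
  by (rule measurable_compose[OF tuple_measurable[OF assms, of "\<lambda>x. x"], of f]) simp

lemma throw_borel_measurable: "i \<ge> 1 \<Longrightarrow> (\<lambda>\<omega>. g (X i \<omega>) :: real) \<in> borel_measurable M"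
  by (rule measurable_compose[OF X_measurable]) auto

text \<open>Ball \<open>i\<close> is independent of the balls in \<open>J\<close>. Used with a
  centred \<open>g\<close>, this removes every contribution that depends on the other balls
  alone.\<close>

lemma expectation_throw_mult:
  fixes f :: "(nat \<Rightarrow> nat) \<Rightarrow> real" and g :: "nat \<Rightarrow> real"
  assumes J: "finite J" "J \<subseteq> {1..}" and i: "i \<ge> 1" "i \<notin> J"
    and f: "\<And>x. \<bar>f x\<bar> \<le> a" and g: "\<And>x. \<bar>g x\<bar> \<le> b"
  shows "expectation (\<lambda>\<omega>. g (X i \<omega>) * f (restrict (\<lambda>l. X l \<omega>) J)) =
    expectation (\<lambda>\<omega>. g (X i \<omega>)) * expectation (\<lambda>\<omega>. f (restrict (\<lambda>l. X l \<omega>) J))"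
proof -
  have "indep_var (PiM {i} (\<lambda>_. count_space {1..})) (\<lambda>\<omega>. restrict (\<lambda>l. X l \<omega>) {i})
      (PiM J (\<lambda>_. count_space {1..})) (\<lambda>\<omega>. restrict (\<lambda>l. X l \<omega>) J)"
    using J i by (intro indep_var_restrict[OF indep]) auto
  then have "indep_var borel ((\<lambda>x. g (x i)) \<circ> (\<lambda>\<omega>. restrict (\<lambda>l. X l \<omega>) {i}))
      borel (f \<circ> (\<lambda>\<omega>. restrict (\<lambda>l. X l \<omega>) J))"
    using J by (rule_tac indep_var_compose) (auto simp: count_space_PiM_finite)
  then have ind: "indep_var borel (\<lambda>\<omega>. g (X i \<omega>)) borel (\<lambda>\<omega>. f (restrict (\<lambda>l. X l \<omega>) J))"
    by (simp add: o_def)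
  have "integrable M (\<lambda>\<omega>. g (X i \<omega>))"
    by (rule integrable_const_bound[where B = b]) (use g i in \<open>auto intro: throw_borel_measurable\<close>)
  moreover have "integrable M (\<lambda>\<omega>. f (restrict (\<lambda>l. X l \<omega>) J))"
    by (rule integrable_const_bound[where B = a]) (use f tuple_borel_measurable[OF J, of f] in auto)
  ultimately show ?thesis
    by (rule indep_var_lebesgue_integral[OF ind])
qed

lemma prob_new_value:
  assumes J: "finite J" "J \<subseteq> {1..}" and i: "i \<ge> 1" "i \<notin> J" and j: "j \<ge> 1"
  shows "prob {\<omega> \<in> space M. X i \<omega> = j \<and> j \<notin> (\<lambda>l. X l \<omega>) ` J} = p j * (1 - p j) ^ card J"
proof -
  \<comment> \<open>\<open>A l\<close> is the set of boxes allowed to ball \<open>l\<close>: the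
    event is that ball \<open>i\<close> hits \<open>j\<close> and every ball of \<open>J\<close>
    avoids it.\<close>
  define A where "A l = (if l = i then {j} else {1..} - {j})" for l
  have ne: "prob (X l -` ({1..} - {j}) \<inter> space M) = 1 - p j" if "l \<in> J" for l
  proof -
    have l: "l \<ge> 1" using that J by auto
    have "X l -` {j} \<inter> space M \<in> events"
      using measurable_sets[OF X_measurable[OF l], of "{j}"] j by auto
    moreover have "X l -` {j} \<inter> space M = {\<omega> \<in> space M. X l \<omega> = j}" by auto
    ultimately have "prob (space M - {\<omega> \<in> space M. X l \<omega> = j}) = 1 - p j"
      using prob_compl prob_eq[OF l j] by auto
    moreover have "space M - {\<omega> \<in> space M. X l \<omega> = j} = X l -` ({1..} - {j}) \<inter> space M"
      using X_pos[OF l] by auto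
    ultimately show ?thesis by simp
  qed
  have X_J: "Suc 0 \<le> X l \<omega>" if "l \<in> J" "\<omega> \<in> space M" for l \<omega>
    using X_pos[of l \<omega>] that J by auto
  have "{\<omega> \<in> space M. X i \<omega> = j \<and> j \<notin> (\<lambda>l. X l \<omega>) ` J} = (\<Inter>l\<in>insert i J. X l -` A l \<inter> space M)"
    using X_J i by (auto simp: A_def image_iff split: if_splits)
  also have "prob \<dots> = (\<Prod>l\<in>insert i J. prob (X l -` A l \<inter> space M))"
    using J i j by (intro indep_varsD[OF indep]) (auto simp: A_def)
  also have "\<dots> = prob (X i -` {j} \<inter> space M) * (\<Prod>l\<in>J. prob (X l -` A l \<inter> space M))"
    using J i by (simp add: A_def)
  also have "(\<Prod>l\<in>J. prob (X l -` A l \<inter> space M)) = (\<Prod>l\<in>J. 1 - p j)"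
    using i ne by (intro prod.cong) (auto simp: A_def)
  also have "X i -` {j} \<inter> space M = {\<omega> \<in> space M. X i \<omega> = j}" by auto
  finally show ?thesis
    using prob_eq[OF i(1) j] by simp
qed

lemma new_value_event:
  assumes "finite J" "J \<subseteq> {1..}" "i \<ge> 1"
  shows "{\<omega> \<in> space M. P (X i \<omega>) \<and> X i \<omega> \<notin> (\<lambda>l. X l \<omega>) ` J} \<in> events"
proof -
  have "(\<lambda>\<omega>. (\<lambda>x. P (x i) \<and> x i \<notin> x ` J) (restrict (\<lambda>l. X l \<omega>) (insert i J)))
      \<in> measurable M (count_space UNIV)"
    using assms by (intro tuple_measurable) auto
  also have "(\<lambda>\<omega>. (\<lambda>x. P (x i) \<and> x i \<notin> x ` J) (restrict (\<lambda>l. X l \<omega>) (insert i J))) =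
      (\<lambda>\<omega>. P (X i \<omega>) \<and> X i \<omega> \<notin> (\<lambda>l. X l \<omega>) ` J)"
    by (auto simp: fun_eq_iff image_iff)
  finally show ?thesis
    by measurable
qed

text \<open>Countable additivity over the box \<open>k + 1\<close> hit by ball \<open>i\<close>.
  Empty \<open>J\<close> gives the law of a single throw; \<open>B = UNIV\<close> gives the
  probability that ball \<open>i\<close> shares its box with no ball of \<open>J\<close>.\<close>

lemma prob_new_sums:
  assumes J: "finite J" "J \<subseteq> {1..}" and i: "i \<ge> 1" "i \<notin> J"
  shows "(\<lambda>k. indicator B (k + 1) * (p (k + 1) * (1 - p (k + 1)) ^ card J)) sums
    prob {\<omega> \<in> space M. X i \<omega> \<in> B \<and> X i \<omega> \<notin> (\<lambda>l. X l \<omega>) ` J}"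
proof -
  define F where
    "F k = {\<omega> \<in> space M. (X i \<omega> = k + 1 \<and> k + 1 \<in> B) \<and> X i \<omega> \<notin> (\<lambda>l. X l \<omega>) ` J}" for k
  have "F k \<in> events" for k
    using new_value_event[OF J i(1), of "\<lambda>x. x = k + 1 \<and> k + 1 \<in> B"] by (simp add: F_def)
  then have "range F \<subseteq> events"
    by auto
  then have "(\<lambda>k. prob (F k)) sums prob (\<Union>k. F k)"
    by (rule finite_measure_UNION) (auto simp: F_def disjoint_family_on_def)
  moreover have "(\<Union>k. F k) = {\<omega> \<in> space M. X i \<omega> \<in> B \<and> X i \<omega> \<notin> (\<lambda>l. X l \<omega>) ` J}"
  proof -
    have "\<omega> \<in> (\<Union>k. F k)" if "\<omega> \<in> space M" "X i \<omega> \<in> B" "X i \<omega> \<notin> (\<lambda>l. X l \<omega>) ` J" for \<omega>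
      using that X_pos[OF i(1), of \<omega>] by (auto simp: F_def intro!: exI[of _ "X i \<omega> - 1"])
    then show ?thesis by (auto simp: F_def)
  qed
  moreover have "prob (F k) = indicator B (k + 1) * (p (k + 1) * (1 - p (k + 1)) ^ card J)" for k
  proof (cases "k + 1 \<in> B")
    case True
    then have "F k = {\<omega> \<in> space M. X i \<omega> = k + 1 \<and> k + 1 \<notin> (\<lambda>l. X l \<omega>) ` J}"
      unfolding F_def by (auto simp: image_iff)
    with True prob_new_value[OF J i, of "k + 1"] show ?thesis by simp
  qed (simp add: F_def)
  ultimately show ?thesis by simp
qed

text \<open>Projection onto the centred count of balls in \<open>B\<close>, with
  \<open>t = d - c\<close>. Here \<open>q\<close> is the probability of \<open>B\<close> and, for
  \<open>n \<ge> 1\<close>, \<open>c\<close> is that of a given ball being alone; the exponent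
  \<open>n - 1\<close> counts the other balls.\<close>

lemma occupancy_variance_ge:
  fixes n :: nat and B :: "nat set"
  defines "q \<equiv> (\<Sum>k. indicator B (k + 1) * p (k + 1))"
    and "c \<equiv> (\<Sum>k. p (k + 1) * (1 - p (k + 1)) ^ (n - 1))"
  assumes d: "\<And>j. j \<ge> 1 \<Longrightarrow> j \<in> B \<Longrightarrow> d \<le> (1 - p j) ^ (n - 1)" and c: "c \<le> d"
  shows "real n * q * (d - c)\<^sup>2 \<le> occupancy_variance M X n"
proof -
  define h where "h x = indicator B x - q" for x :: nat
  define J where "J i = {1..n} - {i}" for i
  define K where "K \<omega> = real (card ((\<lambda>l. X l \<omega>) ` {1..n}))" for \<omega>
  define S where "S \<omega> = (\<Sum>i\<in>{1..n}. h (X i \<omega>))" for \<omega>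
  \<comment> \<open>\<open>new i\<close> indicates that ball \<open>i\<close> is alone in its box;
    \<open>J i\<close> consists of the other balls.\<close>
  define new where "new i \<omega> = (if X i \<omega> \<in> (\<lambda>l. X l \<omega>) ` J i then 0 else 1 :: real)" for i \<omega>
  have J: "finite (J i)" "J i \<subseteq> {1..}" "i \<notin> J i" for i
    by (auto simp: J_def)
  have q: "prob {\<omega> \<in> space M. X i \<omega> \<in> B} = q" if "i \<ge> 1" for i
    using sums_unique[OF prob_new_sums[of "{}" i B]] that by (simp add: q_def)
  have q01: "0 \<le> q" "q \<le> 1"
    using q[of 1, symmetric] by simp_all
  have h: "\<bar>h x\<bar> \<le> 1" for x
    using q01 by (auto simp: h_def indicator_def)
  have B_event: "{\<omega> \<in> space M. X i \<omega> \<in> B} \<in> events" if "i \<ge> 1" for i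
    using new_value_event[of "{}" i "\<lambda>x. x \<in> B"] that by simp
  have indB: "integrable M (\<lambda>\<omega>. indicator B (X i \<omega>) :: real)"
    "expectation (\<lambda>\<omega>. indicator B (X i \<omega>)) = q" if "i \<ge> 1" for i
  proof -
    show "integrable M (\<lambda>\<omega>. indicator B (X i \<omega>) :: real)"
      using that by (auto intro!: integrable_const_bound[where B = 1] throw_borel_measurable)
    have "expectation (\<lambda>\<omega>. indicator B (X i \<omega>)) =
        expectation (indicator {\<omega> \<in> space M. X i \<omega> \<in> B} :: _ \<Rightarrow> real)"
      by (intro Bochner_Integration.integral_cong) (auto simp: indicator_def)
    with B_event[OF that] q[OF that] show "expectation (\<lambda>\<omega>. indicator B (X i \<omega>)) = q"
      by simp
  qed
  have h_mean: "expectation (\<lambda>\<omega>. h (X i \<omega>)) = 0" if "i \<ge> 1" for i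
    using indB[OF that] by (simp add: h_def prob_space)
  have h_meas [measurable]: "(\<lambda>\<omega>. h (X i \<omega>)) \<in> borel_measurable M" if "i \<ge> 1" for i
    by (rule throw_borel_measurable[OF that])
  have S_meas: "S \<in> borel_measurable M"
    unfolding S_def by (intro borel_measurable_sum h_meas) auto
  have h_ind: "expectation (\<lambda>\<omega>. h (X i \<omega>) * f (restrict (\<lambda>l. X l \<omega>) (J i))) = 0"
    if "i \<ge> 1" "\<And>x. \<bar>f x\<bar> \<le> a" for i a and f :: "(nat \<Rightarrow> nat) \<Rightarrow> real"
    using expectation_throw_mult[where f = f and g = h, OF J(1,2) that(1) J(3) that(2) h]
      h_mean[OF that(1)] by simp
  have image_restrict: "restrict (\<lambda>l. X l \<omega>) I ` I = (\<lambda>l. X l \<omega>) ` I" for I \<omega>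
    by auto
  have card_meas: "(\<lambda>\<omega>. real (card ((\<lambda>l. X l \<omega>) ` I))) \<in> borel_measurable M"
    if "finite I" "I \<subseteq> {1..}" for I
    using tuple_borel_measurable[OF that, of "\<lambda>x. real (card (x ` I))"] by (simp add: image_restrict)
  have card_le: "card (x ` I) \<le> n" if "I \<subseteq> {1..n}" for x :: "nat \<Rightarrow> nat" and I
  proof -
    have "card (x ` I) \<le> card I"
      using that by (intro card_image_le) (auto intro: finite_subset)
    also have "\<dots> \<le> n" using card_mono[OF _ that] by simp
    finally show ?thesis .
  qed
  have K_meas: "K \<in> borel_measurable M"
    unfolding K_def by (intro card_meas) auto
  have K_bd: "\<bar>K \<omega>\<bar> \<le> real n" for \<omega>
    using card_le by (simp add: K_def)
  have S_bd: "\<bar>S \<omega>\<bar> \<le> real n" for \<omega>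
  proof -
    have "\<bar>S \<omega>\<bar> \<le> (\<Sum>i\<in>{1..n}. \<bar>h (X i \<omega>)\<bar>)"
      unfolding S_def by (rule sum_abs)
    also have "\<dots> \<le> (\<Sum>i\<in>{1..n}. 1)"
      by (intro sum_mono h)
    finally show ?thesis by simp
  qed
  have h_int: "integrable M (\<lambda>\<omega>. h (X i \<omega>) * f \<omega>)"
    if "i \<ge> 1" "f \<in> borel_measurable M" "\<And>\<omega>. \<bar>f \<omega>\<bar> \<le> a" for i a f
  proof (rule integrable_const_bound[where B = a])
    show "AE \<omega> in M. norm (h (X i \<omega>) * f \<omega>) \<le> a"
      using mult_mono[OF h that(3)] by (auto simp: abs_mult)
  qed (use that in measurable)
  have int_S: "expectation (\<lambda>\<omega>. S \<omega> * f \<omega>) = (\<Sum>i\<in>{1..n}. expectation (\<lambda>\<omega>. h (X i \<omega>) * f \<omega>))"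
    if "f \<in> borel_measurable M" "\<And>\<omega>. \<bar>f \<omega>\<bar> \<le> a" for f a
    unfolding S_def sum_distrib_right
    using that by (intro Bochner_Integration.integral_sum h_int) auto
  have S_mean: "expectation S = 0"
    using int_S[of "\<lambda>_. 1" 1] h_mean by simp
  have S_sq: "expectation (\<lambda>\<omega>. S \<omega> * S \<omega>) \<le> real n * q"
  proof -
    have "expectation (\<lambda>\<omega>. h (X i \<omega>) * S \<omega>) \<le> q" if i: "i \<in> {1..n}" for i
    proof -
      define f where "f x = (\<Sum>l\<in>J i. h (x l))" for x
      have f: "\<bar>f x\<bar> \<le> real n" for x
      proof -
        have "\<bar>f x\<bar> \<le> (\<Sum>l\<in>J i. 1)"
          unfolding f_def by (rule order_trans[OF sum_abs sum_mono[OF h]])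
        also have "\<dots> \<le> real n" using i by (simp add: J_def)
        finally show ?thesis .
      qed
      have f_eq: "f (restrict (\<lambda>l. X l \<omega>) (J i)) = (\<Sum>l\<in>J i. h (X l \<omega>))" for \<omega>
        by (simp add: f_def)
      have S_split: "S \<omega> = h (X i \<omega>) + f (restrict (\<lambda>l. X l \<omega>) (J i))" for \<omega>
        unfolding f_eq unfolding S_def J_def using i by (intro sum.remove) auto
      have "expectation (\<lambda>\<omega>. h (X i \<omega>) * S \<omega>) = expectation (\<lambda>\<omega>. h (X i \<omega>) * h (X i \<omega>))
          + expectation (\<lambda>\<omega>. h (X i \<omega>) * f (restrict (\<lambda>l. X l \<omega>) (J i)))"
        unfolding S_split distrib_left using i J f h
        by (intro Bochner_Integration.integral_add h_int
            tuple_borel_measurable h_meas) auto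
      also have "\<dots> = expectation (\<lambda>\<omega>. h (X i \<omega>) * h (X i \<omega>))"
        using h_ind[of i f, OF _ f] i by simp
      \<comment> \<open>An indicator equals its square, so \<open>h\<^sup>2\<close> is affine in the
        indicator of \<open>B\<close>; its mean is \<open>q - q\<^sup>2\<close>.\<close>
      also have "\<dots> = expectation (\<lambda>\<omega>. (1 - 2 * q) * indicator B (X i \<omega>) + q * q)"
        by (intro Bochner_Integration.integral_cong) (auto simp: h_def indicator_def algebra_simps)
      also have "\<dots> = (1 - 2 * q) * q + q * q"
        using i indB[of i] by (simp add: prob_space)
      also have "\<dots> \<le> q" using q01 by (simp add: algebra_simps)
      finally show ?thesis .
    qed
    then have "expectation (\<lambda>\<omega>. S \<omega> * S \<omega>) \<le> (\<Sum>i\<in>{1..n}. q)"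
      unfolding int_S[OF S_meas S_bd] by (rule sum_mono)
    then show ?thesis by simp
  qed
  have S_K: "expectation (\<lambda>\<omega>. S \<omega> * K \<omega>) \<ge> real n * (q * (d - c))"
  proof -
    have "expectation (\<lambda>\<omega>. h (X i \<omega>) * K \<omega>) \<ge> q * (d - c)" if i: "i \<in> {1..n}" for i
    proof -
      define f where "f x = real (card (x ` J i))" for x :: "nat \<Rightarrow> nat"
      have i1: "i \<ge> 1" using i by auto
      have cJ: "card (J i) = n - 1" using i by (simp add: J_def)
      have f: "\<bar>f x\<bar> \<le> real n" for x
        unfolding f_def using card_le[of "J i" x] by (auto simp: J_def)
      have img: "(\<lambda>l. X l \<omega>) ` {1..n} = insert (X i \<omega>) ((\<lambda>l. X l \<omega>) ` J i)" for \<omega>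
        using i by (auto simp: J_def)
      \<comment> \<open>The second summand depends only on the balls other than \<open>i\<close>, so
        \<open>h_ind\<close> makes its product with \<open>h (X i \<omega>)\<close> average to
        zero.\<close>
      have K_split: "K \<omega> = new i \<omega> + f (restrict (\<lambda>l. X l \<omega>) (J i))" for \<omega>
        unfolding K_def img f_def image_restrict
        using J by (simp add: card_insert_if new_def)
      define NA where "NA A = {\<omega> \<in> space M. X i \<omega> \<in> A \<and> X i \<omega> \<notin> (\<lambda>l. X l \<omega>) ` J i}" for A
      have NA_ev: "NA A \<in> events" for A
        unfolding NA_def by (rule new_value_event[OF J(1,2) i1])
      have "new i \<in> borel_measurable M \<longleftrightarrow> (indicator (NA UNIV) :: _ \<Rightarrow> real) \<in> borel_measurable M"
        by (rule measurable_cong) (auto simp: NA_def new_def)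
      then have new_meas: "new i \<in> borel_measurable M"
        using NA_ev by simp
      have new_le: "\<bar>new i \<omega>\<bar> \<le> 1" for \<omega>
        by (simp add: new_def)
      have "expectation (\<lambda>\<omega>. h (X i \<omega>) * K \<omega>) = expectation (\<lambda>\<omega>. h (X i \<omega>) * new i \<omega>)
          + expectation (\<lambda>\<omega>. h (X i \<omega>) * f (restrict (\<lambda>l. X l \<omega>) (J i)))"
        unfolding K_split distrib_left using i1 J(1,2) f new_meas new_le
        by (intro Bochner_Integration.integral_add h_int tuple_borel_measurable)
      also have "\<dots> = expectation (\<lambda>\<omega>. h (X i \<omega>) * new i \<omega>)"
        using h_ind[of i f, OF _ f] i by simp
      also have "\<dots> = expectation (\<lambda>\<omega>. indicator (NA B) \<omega> - q * indicator (NA UNIV) \<omega>)"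
        by (intro Bochner_Integration.integral_cong)
          (auto simp: h_def new_def NA_def indicator_def)
      also have "\<dots> = prob (NA B) - q * prob (NA UNIV)"
        using NA_ev by (simp add: emeasure_eq_measure)
      also have "prob (NA UNIV) = c"
        using sums_unique[OF prob_new_sums[OF J(1,2) i1 J(3), of UNIV]]
        by (simp add: NA_def c_def cJ)
      finally have "expectation (\<lambda>\<omega>. h (X i \<omega>) * K \<omega>) = prob (NA B) - q * c" .
      \<comment> \<open>Compare the two series box by box: inside \<open>B\<close> the chance of
        avoidance by the other \<open>n - 1\<close> balls is at least \<open>d\<close>.\<close>
      moreover have "d * q \<le> prob (NA B)"
      proof (rule sums_le)
        show "(\<lambda>k. indicator B (k + 1) * (p (k + 1) * (1 - p (k + 1)) ^ card (J i))) sums prob (NA B)"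
          unfolding NA_def by (rule prob_new_sums[OF J(1,2) i1 J(3)])
        have "(\<lambda>k. indicator B (k + 1) * p (k + 1)) sums q"
          using prob_new_sums[of "{}" i B] i1 q[of i] by simp
        then show "(\<lambda>k. d * (indicator B (k + 1) * p (k + 1))) sums (d * q)"
          by (rule sums_mult)
        show "d * (indicator B (k + 1) * p (k + 1)) \<le>
            indicator B (k + 1) * (p (k + 1) * (1 - p (k + 1)) ^ card (J i))" for k
          using mult_left_mono[OF d[of "k + 1"], of "p (k + 1)"] p_nonneg[of "k + 1"]
          by (auto simp: cJ indicator_def mult.commute)
      qed
      ultimately show ?thesis by (simp add: algebra_simps)
    qed
    then have "(\<Sum>i\<in>{1..n}. q * (d - c)) \<le> expectation (\<lambda>\<omega>. S \<omega> * K \<omega>)"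
      unfolding int_S[OF K_meas K_bd] by (rule sum_mono)
    then show ?thesis by simp
  qed
  \<comment> \<open>This is the projection bound at \<open>t = d - c\<close> with \<open>S_K\<close>
    and \<open>S_sq\<close> inserted; \<open>c \<le> d\<close> keeps the coefficient of the
    covariance nonnegative.\<close>
  have "real n * q * (d - c)\<^sup>2 =
      2 * (d - c) * (real n * (q * (d - c))) - (d - c)\<^sup>2 * (real n * q)"
    by (simp add: power2_eq_square algebra_simps)
  also have "\<dots> \<le> 2 * (d - c) * expectation (\<lambda>\<omega>. S \<omega> * K \<omega>) - (d - c)\<^sup>2 * expectation (\<lambda>\<omega>. S \<omega> * S \<omega>)"
    using c by (intro diff_mono mult_left_mono S_K S_sq) auto
  also have "\<dots> \<le> variance K"
    by (rule variance_ge_projection[OF K_meas S_meas K_bd S_bd S_mean])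
  also have "\<dots> = occupancy_variance M X n"
  proof -
    have "{j. \<exists>i\<in>{1..n}. X i \<omega> = j} = (\<lambda>l. X l \<omega>) ` {1..n}" for \<omega>
      by auto
    then show ?thesis
      by (simp add: occupancy_variance_def num_occupied_def K_def [abs_def])
  qed
  finally show ?thesis .
qed

end

section \<open>Vanishing of the chance to be alone, and divergence of the tail ratio\<close>

text \<open>Each term vanishes since \<open>0 \<le> 1 - a k < 1\<close>, and the summable
  \<open>a\<close> dominates all terms, so limit and sum may be exchanged. For
  \<open>a k = p (k + 1)\<close> the sum is the chance \<open>c\<close> that a ball is
  alone.\<close>

lemma suminf_power_tendsto_0:
  fixes a :: "nat \<Rightarrow> real"
  assumes "summable a" and a: "\<And>k. 0 < a k" "\<And>k. a k \<le> 1"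
  shows "(\<lambda>n. \<Sum>k. a k * (1 - a k) ^ (n - 1)) \<longlonglongrightarrow> 0"
proof -
  have lim: "(\<lambda>n. a k * (1 - a k) ^ (n - 1)) \<longlonglongrightarrow> 0" for k
  proof -
    have "(\<lambda>n. (1 - a k) ^ n) \<longlonglongrightarrow> 0"
      using a[of k] by (intro LIMSEQ_power_zero) auto
    then have "(\<lambda>n. (1 - a k) ^ (n - 1)) \<longlonglongrightarrow> 0"
      by (subst filterlim_sequentially_Suc[symmetric]) simp
    then show ?thesis
      by (rule tendsto_mult_right_zero)
  qed
  have bound: "norm (a k * (1 - a k) ^ (n - 1)) \<le> a k" for k n
    using a[of k] by (simp add: abs_mult power_le_one mult_le_cancel_left1)
  have "\<forall>\<^sub>F (k, n) in sequentially \<times>\<^sub>F sequentially.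
      norm (a k * (1 - a k) ^ (n - 1)) \<le> a k"
    using bound by (intro always_eventually) (simp del: One_nat_def)
  from tannerys_theorem[OF lim this \<open>summable a\<close>] show ?thesis
    by simp
qed

text \<open>Eventually each of the first \<open>m\<close> ratios exceeds \<open>1/4\<close>, a value
  strictly below the liminf bound \<open>1/2\<close>; hence the tail ratio is at least
  \<open>m / 4\<close>, and \<open>m\<close> is arbitrary.\<close>

lemma tail_ratio_at_top:
  fixes p :: "nat \<Rightarrow> real"
  assumes pos: "\<And>j. j \<ge> 1 \<Longrightarrow> p j > 0" and sm: "summable (\<lambda>j. p (j + 1))"
    and lim: "\<And>k. k \<ge> 1 \<Longrightarrow> liminf (\<lambda>j. ereal (p (j + k) / p j)) \<ge> ereal (1/2)"
  shows "filterlim (tail_ratio p) at_top sequentially"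
  unfolding filterlim_at_top
proof
  fix Z :: real
  obtain m :: nat where m: "4 * Z \<le> real m" "m \<ge> 1"
    using real_arch_simple[of "max 1 (4 * Z)"] by auto
  have "\<forall>\<^sub>F j in sequentially. \<forall>k\<in>{1..m}. 1/4 < p (j + k) / p j"
  proof (rule eventually_ball_finite[OF _ ballI])
    fix k assume "k \<in> {1..m}"
    then have "ereal (1/2) \<le> liminf (\<lambda>j. ereal (p (j + k) / p j))"
      by (intro lim) simp
    then have "ereal (1/4) < liminf (\<lambda>j. ereal (p (j + k) / p j))"
      by (rule less_le_trans[rotated]) simp
    then have "\<forall>\<^sub>F j in sequentially. ereal (1/4) < ereal (p (j + k) / p j)"
      by (rule less_LiminfD)
    then show "\<forall>\<^sub>F j in sequentially. 1/4 < p (j + k) / p j"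
      by simp
  qed simp
  then show "\<forall>\<^sub>F j in sequentially. Z \<le> tail_ratio p j"
    using eventually_ge_at_top[of 1]
  proof eventually_elim
    case (elim j)
    have ratio: "1/4 \<le> p (j + 1 + k) / p j" if "k < m" for k
      using elim(1)[rule_format, of "k + 1"] that by (simp add: add_ac)
    have "Z \<le> (\<Sum>k<m. 1/4)" using m by simp
    also have "\<dots> \<le> (\<Sum>k<m. p (j + 1 + k) / p j)"
      using ratio by (intro sum_mono) auto
    also have "\<dots> = (\<Sum>k<m. p (j + 1 + k)) / p j"
      by (simp add: sum_divide_distrib)
    also have "\<dots> \<le> tail_ratio p j"
      unfolding tail_ratio_def
    proof (intro divide_right_mono sum_le_suminf)
      show "summable (\<lambda>k. p (j + 1 + k))"
        using summable_ignore_initial_segment[OF sm, of j] by (simp add: add_ac)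
      show "0 \<le> p j" using pos[OF elim(2)] by simp
      show "0 \<le> p (j + 1 + k)" for k using pos[of "j + 1 + k"] by simp
    qed auto
    finally show ?case .
  qed
qed

section \<open>The two implications\<close>

theorem theorem1p3:
  fixes p :: "nat \<Rightarrow> real" and M :: "'w measure" and X :: "nat \<Rightarrow> 'w \<Rightarrow> nat"
  assumes pos: "\<And>j. j \<ge> 1 \<Longrightarrow> p j > 0"
    and noninc: "\<And>j. j \<ge> 1 \<Longrightarrow> p (j + 1) \<le> p j"
    and total: "(\<lambda>j. p (j + 1)) sums 1"
    and scheme: "occupancy_scheme M p X"
  shows "((\<forall>k\<ge>1. liminf (\<lambda>j. ereal (p (j + k) / p j)) \<ge> ereal (1/2)) \<longrightarrow>
            filterlim (tail_ratio p) at_top sequentially) \<and>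
         (filterlim (tail_ratio p) at_top sequentially \<longrightarrow>
            filterlim (occupancy_variance M X) at_top sequentially)"
proof (intro conjI impI)
  have sm: "summable (\<lambda>j. p (j + 1))"
    using total by (rule sums_summable)
  {
    assume "\<forall>k\<ge>1. liminf (\<lambda>j. ereal (p (j + k) / p j)) \<ge> ereal (1/2)"
    then show "filterlim (tail_ratio p) at_top sequentially"
      using tail_ratio_at_top[of p, OF pos sm] by blast
  next
    assume rho: "filterlim (tail_ratio p) at_top sequentially"
    interpret prob_space M
      using scheme by (simp add: occupancy_scheme_def)
    interpret occupancy M p X
      using scheme by unfold_locales (auto simp: occupancy_scheme_def)
    define c where "c n = (\<Sum>k. p (k + 1) * (1 - p (k + 1)) ^ (n - 1))" for n :: nat
    have c0: "c \<longlonglongrightarrow> 0"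
      unfolding c_def using pos p_le_1 by (intro suminf_power_tendsto_0[OF sm]) auto
    have p0: "p \<longlonglongrightarrow> 0"
      using summable_LIMSEQ_zero[OF sm] LIMSEQ_offset[of p 1] by blast
    show "filterlim (occupancy_variance M X) at_top sequentially"
      unfolding filterlim_at_top_gt[where c = 0]
    proof safe
      fix Z :: real
      assume "0 < Z"
      \<comment> \<open>The factor 32 pays for \<open>n * p j > 1/2\<close> and for
        \<open>(1/2 - c n)\<^sup>2 \<ge> 1/16\<close>, the latter from
        \<open>c n < 1/4\<close>.\<close>
      obtain m where m: "\<And>j. j \<ge> m \<Longrightarrow> 32 * Z \<le> tail_ratio p j"
        using rho unfolding filterlim_at_top eventually_sequentially by blast
      define m' where "m' = max 1 m"
      have "\<forall>\<^sub>F n in sequentially. c n < 1/4"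
        using c0 by (rule order_tendstoD) simp
      \<comment> \<open>For such \<open>n\<close> the box \<open>m'\<close> satisfies
        \<open>2 * n * p m' > 1\<close>, so the last box with this property lies at or beyond
        \<open>m'\<close>, where the tail ratio is known to be large. The maximum with 1 makes
        \<open>m'\<close> an actual box.\<close>
      moreover have "\<forall>\<^sub>F n in sequentially. inverse (2 * p m') < real n"
        using filterlim_real_sequentially unfolding filterlim_at_top_dense by blast
      ultimately show "\<forall>\<^sub>F n in sequentially. Z \<le> occupancy_variance M X n"
        using eventually_gt_at_top[of 0]
      proof eventually_elim
        case (elim n)
        define big where "big j \<longleftrightarrow> j \<ge> 1 \<and> 1 < 2 * real n * p j" for j
        have "big m'"
          using elim(2) pos[of m'] by (simp add: big_def m'_def field_simps)
        have "\<forall>\<^sub>F j in sequentially. p j < 1 / (2 * real n)"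
          using p0 by (rule order_tendstoD) (use elim in simp)
        then obtain b where b: "\<And>j. j \<ge> b \<Longrightarrow> p j < 1 / (2 * real n)"
          unfolding eventually_sequentially by blast
        \<comment> \<open>Since \<open>p\<close> tends to 0, the big boxes are bounded, which makes
          \<open>Greatest big\<close> a true maximum.\<close>
        have bd: "\<forall>j. big j \<longrightarrow> j \<le> b"
        proof safe
          fix j assume "big j"
          then have "\<not> p j < 1 / (2 * real n)"
            using elim by (simp add: big_def field_simps)
          with b[of j] show "j \<le> b" by linarith
        qed
        define j where "j = Greatest big"
        have j: "big j" "\<And>i. i > j \<Longrightarrow> \<not> big i" "m' \<le> j"
          using GreatestI_nat[of big m' b] Greatest_le_nat[of big _ b] bd \<open>big m'\<close>
          by (force simp: j_def)+
        have j1: "j \<ge> 1" using j(1) by (simp add: big_def)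
        \<comment> \<open>The first \<open>j\<close> terms are boxes \<open>1\<close> to
          \<open>j\<close>, outside \<open>{j<..}\<close>; what remains is the tail after
          \<open>j\<close>, the numerator of \<open>tail_ratio p j\<close>.\<close>
        have q: "(\<Sum>k. indicator {j<..} (k + 1) * p (k + 1)) = tail_ratio p j * p j"
        proof -
          have "summable (\<lambda>k. indicator {j<..} (k + 1) * p (k + 1))"
            by (rule summable_comparison_test'[OF sm, of 0])
              (use pos in \<open>auto simp: indicator_def less_imp_le\<close>)
          then have "(\<Sum>k. indicator {j<..} (k + 1) * p (k + 1)) =
              (\<Sum>k. indicator {j<..} (k + j + 1) * p (k + j + 1)) +
              (\<Sum>k<j. indicator {j<..} (k + 1) * p (k + 1))"
            by (rule suminf_split_initial_segment)
          also have "(\<Sum>k<j. indicator {j<..} (k + 1) * p (k + 1)) = 0"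
            by (intro sum.neutral) auto
          finally show ?thesis
            using pos[OF j1] by (simp add: tail_ratio_def add_ac)
        qed
        have "16 * Z \<le> real n * (tail_ratio p j * p j)"
        proof -
          have "32 * Z * (1 / 2) \<le> tail_ratio p j * (real n * p j)"
            using m[of j] j \<open>0 < Z\<close> by (intro mult_mono) (auto simp: m'_def big_def)
          then show ?thesis by (simp add: mult_ac)
        qed
        then have "Z \<le> real n * (tail_ratio p j * p j) * (1/4)\<^sup>2"
          by (simp add: power2_eq_square)
        also have "\<dots> \<le> real n * (tail_ratio p j * p j) * (1/2 - c n)\<^sup>2"
          using elim(1) m[of j] j \<open>0 < Z\<close> pos[OF j1]
          by (intro mult_left_mono power_mono) (auto simp: m'_def)
        also have "\<dots> \<le> occupancy_variance M X n"
          unfolding q[symmetric] c_def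
        proof (rule occupancy_variance_ge)
          show "(\<Sum>k. p (k + 1) * (1 - p (k + 1)) ^ (n - 1)) \<le> 1/2"
            using elim(1) by (simp add: c_def)
          fix i :: nat
          assume i: "i \<ge> 1" "i \<in> {j<..}"
          then have np: "2 * real n * p i \<le> 1"
            using j(2)[of i] by (auto simp: big_def)
          \<comment> \<open>Past the last big box \<open>n * p i \<le> 1/2\<close>, so Bernoulli's
            inequality shows that \<open>d = 1/2\<close> is admissible.\<close>
          have "1/2 \<le> 1 - real (n - 1) * p i"
            using np pos[OF i(1)] elim(3) by (simp add: of_nat_diff algebra_simps)
          also have "\<dots> \<le> (1 - p i) ^ (n - 1)"
            using Bernoulli_inequality[of "- p i" "n - 1"] p_le_1[OF i(1)] by simp
          finally show "1/2 \<le> (1 - p i) ^ (n - 1)" .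
        qed
        finally show ?case .
      qed
    qed
  }
qed

end
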